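(* Let $(B,g_B)$ and $(F,g_F)$ be singular semi-Riemannian manifolds, $b:B\times F\to\mathbb R$ smooth, and $\mathcal K$ the Koszul form of the (possibly degenerate) twisted product $B\times_bF$. For all $X,Y,Z\in\Gamma(TB)$ and $U,V,W\in\Gamma(TF)$: (1) $\mathcal K(X,Y,Z)=\mathcal K_B(X,Y,Z)$; (2) $\mathcal K(X,Y,W)=\mathcal K(X,W,Y)=\mathcal K(W,X,Y)=0$; (3) $\mathcal K(X,V,W)=\mathcal K(V,X,W)=-\mathcal K(V,W,X)=bX(b)g_F(V,W)$; (4) $\mathcal K(U,V,W)=bU(b)g_F(V,W)+bV(b)g_F(W,U)-bW(b)g_F(U,V)+b^2\mathcal K_F(U,V,W)$.
   Context: A singular semi-Riemannian manifold $(M,g)$ is a smooth manifold with a smooth symmetric bilinear form $g$ on $TM$, possibly degenerate and of variable signature. Its Koszul form is $\mathcal K(X,Y,Z)=\frac12\{X(g(Y,Z))+Y(g(Z,X))-Z(g(X,Y))-g(X,[Y,Z])+g(Y,[Z,X])+g(Z,[X,Y])\}$. The twisted product $B\times_bF$ with twisting function $b:B\times F\to\mathbb R$ (smooth, possibly vanishing) is $B\times F$ with $g=\pi_B^*(g_B)+b^2\pi_F^*(g_F)$, $\pi_B,\pi_F$ the canonical projections. Vector fields in $\Gamma(TB)$, $\Gamma(TF)$ are identified with their lifts to the product, and functions and tensors on the factors with their pullbacks. $\mathcal K_B$, $\mathcal K_F$ are (the lifts of) the Koszul forms of $(B,g_B)$, $(F,g_F)$. *)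

theory Defs
  imports "HOL-Analysis.Analysis"
begin

section \<open>Smooth manifolds\<close>

text \<open>For open \<open>S\<close> in a finite-dimensional space this is the usual class \<open>C\<^sup>k\<close>, except that level
  \<open>k\<close> also asks for Frechet differentiability of the partial derivatives of order below \<open>k\<close>
  (automatic from \<open>C\<^sup>k\<close>).\<close>

primrec times_differentiable_on ::
    "nat \<Rightarrow> 'e::real_normed_vector set \<Rightarrow> ('e \<Rightarrow> 'f::real_normed_vector) \<Rightarrow> bool" where
  "times_differentiable_on 0 S f \<longleftrightarrow> continuous_on S f"
| "times_differentiable_on (Suc k) S f \<longleftrightarrow>
     (\<forall>x\<in>S. f differentiable (at x)) \<and>
     (\<forall>v. times_differentiable_on k S (\<lambda>x. frechet_derivative f (at x) v))"

definition smooth_on :: "'e::real_normed_vector set \<Rightarrow> ('e \<Rightarrow> 'f::real_normed_vector) \<Rightarrow> bool" where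
  "smooth_on S f \<longleftrightarrow> (\<forall>k. times_differentiable_on k S f)"

text \<open>A chart is a pair \<open>(U, \<phi>)\<close> of a domain and a coordinate map; the values of \<open>\<phi>\<close> outside \<open>U\<close>
  play no role.\<close>

type_synonym ('a, 'e) atlas = "('a set \<times> ('a \<Rightarrow> 'e)) set"

text \<open>The manifold is the whole type \<open>'a\<close>. The atlas need not be maximal. The model space is an
  arbitrary finite-dimensional normed space rather than a \<open>euclidean_space\<close>, since the latter class
  excludes dimension zero.\<close>

definition smooth_manifold ::
    "('a::{t2_space, second_countable_topology}, 'e::real_normed_vector) atlas \<Rightarrow> bool" where
  "smooth_manifold A \<longleftrightarrow>
     (\<exists>S::'e set. finite S \<and> span S = UNIV) \<and>
     (\<Union>(U, \<phi>)\<in>A. U) = UNIV \<and>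
     (\<forall>(U, \<phi>)\<in>A. open U \<and> open (\<phi> ` U) \<and> homeomorphism U (\<phi> ` U) \<phi> (inv_into U \<phi>)) \<and>
     (\<forall>(U, \<phi>)\<in>A. \<forall>(V, \<psi>)\<in>A. smooth_on (\<phi> ` (U \<inter> V)) (\<psi> \<circ> inv_into U \<phi>))"

definition prod_atlas ::
    "('a, 'e) atlas \<Rightarrow> ('b, 'f) atlas \<Rightarrow> ('a \<times> 'b, 'e \<times> 'f) atlas" where
  "prod_atlas A A' = {(U \<times> V, map_prod \<phi> \<psi>) | U \<phi> V \<psi>. (U, \<phi>) \<in> A \<and> (V, \<psi>) \<in> A'}"

definition smooth_functions :: "('a, 'e::real_normed_vector) atlas \<Rightarrow> ('a \<Rightarrow> real) set" where
  "smooth_functions A = {f. \<forall>(U, \<phi>)\<in>A. smooth_on (\<phi> ` U) (f \<circ> inv_into U \<phi>)}"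


section \<open>Tangent vectors and vector fields\<close>

text \<open>Tangent vectors at \<open>p\<close> are derivations at \<open>p\<close> of the algebra of smooth functions. They are
  extended by \<open>0\<close> to non-smooth functions, so that two tangent vectors are equal iff they agree on
  smooth functions.\<close>

type_synonym 'a tangent = "('a \<Rightarrow> real) \<Rightarrow> real"

definition tangent_space :: "('a, 'e::real_normed_vector) atlas \<Rightarrow> 'a \<Rightarrow> 'a tangent set" where
  "tangent_space A p = {v.
     (\<forall>f\<in>smooth_functions A. \<forall>h\<in>smooth_functions A. \<forall>a c.
        v (\<lambda>x. a * f x + c * h x) = a * v f + c * v h) \<and>
     (\<forall>f\<in>smooth_functions A. \<forall>h\<in>smooth_functions A.
        v (\<lambda>x. f x * h x) = v f * h p + f p * v h) \<and>
     (\<forall>f. f \<notin> smooth_functions A \<longrightarrow> v f = 0)}"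

definition differential ::
    "('b, 'f::real_normed_vector) atlas \<Rightarrow> ('a \<Rightarrow> 'b) \<Rightarrow> 'a tangent \<Rightarrow> 'b tangent" where
  "differential A' \<Phi> v = (\<lambda>f. if f \<in> smooth_functions A' then v (f \<circ> \<Phi>) else 0)"

definition vector_fields :: "('a, 'e::real_normed_vector) atlas \<Rightarrow> ('a \<Rightarrow> 'a tangent) set" where
  "vector_fields A = {X. (\<forall>p. X p \<in> tangent_space A p) \<and>
     (\<forall>f\<in>smooth_functions A. (\<lambda>p. X p f) \<in> smooth_functions A)}"

definition lie_bracket ::
    "('a \<Rightarrow> 'a tangent) \<Rightarrow> ('a \<Rightarrow> 'a tangent) \<Rightarrow> 'a \<Rightarrow> 'a tangent" where
  "lie_bracket X Y = (\<lambda>p f. X p (\<lambda>q. Y q f) - Y p (\<lambda>q. X q f))"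


section \<open>Singular semi-Riemannian manifolds\<close>

text \<open>\<open>g p\<close> only matters on the tangent space at \<open>p\<close>. Nondegeneracy and constancy of rank or
  signature are deliberately not required.\<close>

definition singular_semi_riemannian ::
    "('a::{t2_space, second_countable_topology}, 'e::real_normed_vector) atlas
      \<Rightarrow> ('a \<Rightarrow> 'a tangent \<Rightarrow> 'a tangent \<Rightarrow> real) \<Rightarrow> bool" where
  "singular_semi_riemannian A g \<longleftrightarrow>
     smooth_manifold A \<and>
     (\<forall>p. \<forall>v\<in>tangent_space A p. \<forall>w\<in>tangent_space A p. g p v w = g p w v) \<and>
     (\<forall>p. \<forall>v\<in>tangent_space A p. \<forall>w\<in>tangent_space A p. \<forall>u\<in>tangent_space A p. \<forall>a c.
        g p (\<lambda>f. a * v f + c * w f) u = a * g p v u + c * g p w u) \<and>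
     (\<forall>X\<in>vector_fields A. \<forall>Y\<in>vector_fields A. (\<lambda>p. g p (X p) (Y p)) \<in> smooth_functions A)"

definition koszul ::
    "('a \<Rightarrow> 'a tangent \<Rightarrow> 'a tangent \<Rightarrow> real)
      \<Rightarrow> ('a \<Rightarrow> 'a tangent) \<Rightarrow> ('a \<Rightarrow> 'a tangent) \<Rightarrow> ('a \<Rightarrow> 'a tangent) \<Rightarrow> 'a \<Rightarrow> real" where
  "koszul g X Y Z = (\<lambda>p. 1 / 2 *
     (X p (\<lambda>q. g q (Y q) (Z q)) + Y p (\<lambda>q. g q (Z q) (X q)) - Z p (\<lambda>q. g q (X q) (Y q))
      - g p (X p) (lie_bracket Y Z p) + g p (Y p) (lie_bracket Z X p)
      + g p (Z p) (lie_bracket X Y p)))"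


section \<open>Twisted products\<close>

definition twisted_metric ::
    "('b, 'e::real_normed_vector) atlas \<Rightarrow> ('b \<Rightarrow> 'b tangent \<Rightarrow> 'b tangent \<Rightarrow> real)
      \<Rightarrow> ('f, 'd::real_normed_vector) atlas \<Rightarrow> ('f \<Rightarrow> 'f tangent \<Rightarrow> 'f tangent \<Rightarrow> real)
      \<Rightarrow> ('b \<times> 'f \<Rightarrow> real)
      \<Rightarrow> 'b \<times> 'f \<Rightarrow> ('b \<times> 'f) tangent \<Rightarrow> ('b \<times> 'f) tangent \<Rightarrow> real" where
  "twisted_metric AB gB AF gF b = (\<lambda>r v w.
     gB (fst r) (differential AB fst v) (differential AB fst w)
     + (b r)\<^sup>2 * gF (snd r) (differential AF snd v) (differential AF snd w))"

text \<open>The lift of \<open>X\<close> on \<open>B\<close> to \<open>B \<times> F\<close> is, at \<open>(p, q)\<close>, the vector tangent to the leaf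
  \<open>B \<times> {q}\<close> that projects to \<open>X p\<close>, i.e. the image of \<open>X p\<close> under the differential of the
  inclusion \<open>x \<mapsto> (x, q)\<close>; similarly for \<open>F\<close>.\<close>

definition lift_base ::
    "('b, 'e::real_normed_vector) atlas \<Rightarrow> ('f, 'd::real_normed_vector) atlas
      \<Rightarrow> ('b \<Rightarrow> 'b tangent) \<Rightarrow> 'b \<times> 'f \<Rightarrow> ('b \<times> 'f) tangent" where
  "lift_base AB AF X = (\<lambda>(p, q). differential (prod_atlas AB AF) (\<lambda>x. (x, q)) (X p))"

definition lift_fibre ::
    "('b, 'e::real_normed_vector) atlas \<Rightarrow> ('f, 'd::real_normed_vector) atlas
      \<Rightarrow> ('f \<Rightarrow> 'f tangent) \<Rightarrow> 'b \<times> 'f \<Rightarrow> ('b \<times> 'f) tangent" where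
  "lift_fibre AB AF V = (\<lambda>(p, q). differential (prod_atlas AB AF) (\<lambda>y. (p, y)) (V q))"

end

theory Submission
  imports Defs
begin

text \<open>The metric of \<open>B \<times>\<^sub>b F\<close> sees a tangent vector only through its two projections, so the
  natural class of fields is larger than the lifts: those fields \<open>E\<close> on the product that project to
  a field \<open>X\<close> on \<open>B\<close> and to a field \<open>U\<close> on \<open>F\<close> (\<open>projects_to\<close>). For three such fields every
  term of the Koszul formula can be computed.

  A metric term \<open>g(E2, E3)\<close> is \<open>g\<^sub>B(X2, X3) + b\<^sup>2 g\<^sub>F(U2, U3)\<close>, and the Leibniz rule
  (\<open>derivative_twisted_sum\<close>) gives its derivative along \<open>E1\<close>: the derivatives taken in the factors,
  and the extra term \<open>2 b E1(b) g\<^sub>F(U2, U3)\<close> from differentiating \<open>b\<^sup>2\<close>. Brackets of fields that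
  are related by a map are again related by it (\<open>lie_bracket_related\<close>), so \<open>[E2, E3]\<close> projects to
  \<open>[X2, X3]\<close> and \<open>[U2, U3]\<close>, and the bracket terms split without any extra contribution. Adding
  up gives the formula \<open>koszul_projects_to\<close>, in which the two Koszul forms of the factors appear
  with coefficients \<open>1\<close> and \<open>b\<^sup>2\<close> next to three terms in the derivative of \<open>b\<close>.

  The lift of \<open>X\<close> from \<open>B\<close> projects to \<open>(X, 0)\<close> and the lift of \<open>V\<close> from \<open>F\<close> to \<open>(0, V)\<close>.
  Each identity of the theorem is therefore an instance of that one formula, where the terms
  that contain a zero field vanish (\<open>koszul_zero\<close>).

  All of this is algebra with derivations, once a modest amount of analysis is in place: smooth
  functions form an algebra, and pulling back along the projections and along the inclusions of
  the leaves preserves smoothness. In product charts these maps are affine, so composition with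
  affine maps is the only chain rule required.\<close>

section \<open>Calculus of smooth functions\<close>

lemma times_differentiable_on_cong:
  fixes f g :: "'e::real_normed_vector \<Rightarrow> 'f::real_normed_vector"
  assumes "open S" "\<And>x. x \<in> S \<Longrightarrow> f x = g x" "times_differentiable_on k S f"
  shows "times_differentiable_on k S g"
  using assms(2,3)
proof (induction k arbitrary: f g)
  case 0
  then show ?case by (simp cong: continuous_on_cong)
next
  case (Suc k)
  have D: "(g has_derivative frechet_derivative f (at x)) (at x)" if "x \<in> S" for x
  proof -
    have "(f has_derivative frechet_derivative f (at x)) (at x)"
      using Suc.prems(2) that by (simp flip: frechet_derivative_works)
    then show ?thesis
      by (rule has_derivative_transform_within_open[OF _ assms(1) that]) (rule Suc.prems(1))
  qed
  have "times_differentiable_on k S (\<lambda>x. frechet_derivative g (at x) v)" for v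
    using Suc.IH[of "\<lambda>x. frechet_derivative f (at x) v"] Suc.prems(2) frechet_derivative_at[OF D]
    by fastforce
  then show ?case using D by (auto simp: differentiable_def)
qed

lemma times_differentiable_on_SucI:
  fixes f :: "'e::real_normed_vector \<Rightarrow> 'f::real_normed_vector"
  assumes "open S" and D: "\<And>x. x \<in> S \<Longrightarrow> (f has_derivative D x) (at x)"
    and "\<And>v. times_differentiable_on k S (\<lambda>x. D x v)"
  shows "times_differentiable_on (Suc k) S f"
proof -
  have "times_differentiable_on k S (\<lambda>x. frechet_derivative f (at x) v)" for v
    by (rule times_differentiable_on_cong[OF assms(1) _ assms(3)[of v]])
      (simp flip: frechet_derivative_at[OF D])
  with D show ?thesis by (auto simp: differentiable_def)
qed

lemma times_differentiable_on_Suc_imp: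
  fixes f :: "'e::real_normed_vector \<Rightarrow> 'f::real_normed_vector"
  assumes "times_differentiable_on (Suc k) S f"
  shows "times_differentiable_on k S f"
  using assms
proof (induction k arbitrary: f)
  case 0
  then show ?case
    by (auto intro!: continuous_at_imp_continuous_on differentiable_imp_continuous_within)
next
  case (Suc k)
  then show ?case by (metis times_differentiable_on.simps(2))
qed

lemma times_differentiable_on_const: "times_differentiable_on k S (\<lambda>_. c)"
  by (induction k arbitrary: c) auto

text \<open>Along the map \<open>x \<mapsto> L x + c\<close> the derivative in direction \<open>v\<close> pulls back to the derivative in the
  constant direction \<open>L v\<close>, so induction on the order needs no chain rule of higher order.\<close>

lemma times_differentiable_on_affine:
  fixes f :: "'e::real_normed_vector \<Rightarrow> 'f::real_normed_vector"
    and L :: "'d::real_normed_vector \<Rightarrow> 'e"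
  assumes "open S" and L: "bounded_linear L" and sub: "(\<lambda>x. L x + c) ` S \<subseteq> T"
    and "times_differentiable_on k T f"
  shows "times_differentiable_on k S (\<lambda>x. f (L x + c))"
  using assms(4)
proof (induction k arbitrary: f)
  case 0
  have "continuous_on S (\<lambda>x. L x + c)"
    by (intro continuous_intros linear_continuous_on L)
  with 0 show ?case
    using continuous_on_compose2[OF _ _ sub, of f] by simp
next
  case (Suc k)
  show ?case
  proof (rule times_differentiable_on_SucI[OF assms(1)])
    show "((\<lambda>x. f (L x + c)) has_derivative
        (\<lambda>v. frechet_derivative f (at (L x + c)) (L v))) (at x)" if "x \<in> S" for x
    proof (rule has_derivative_compose[where f = "\<lambda>x. L x + c"])
      show "((\<lambda>x. L x + c) has_derivative L) (at x)"
        using has_derivative_add[OF bounded_linear_imp_has_derivative[OF L] has_derivative_const]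
        by simp
      show "(f has_derivative frechet_derivative f (at (L x + c))) (at (L x + c))"
        using Suc.prems that sub by (auto simp flip: frechet_derivative_works)
    qed
    show "times_differentiable_on k S (\<lambda>x. frechet_derivative f (at (L x + c)) (L v))" for v
      using Suc by auto
  qed
qed

lemma times_differentiable_on_lincomb:
  fixes f h :: "'e::real_normed_vector \<Rightarrow> real"
  assumes "open S" "times_differentiable_on k S f" "times_differentiable_on k S h"
  shows "times_differentiable_on k S (\<lambda>x. a * f x + c * h x)"
  using assms(2,3)
proof (induction k arbitrary: f h)
  case 0
  then show ?case by (auto intro!: continuous_intros)
next
  case (Suc k)
  show ?case
  proof (rule times_differentiable_on_SucI[OF assms(1)])
    show "((\<lambda>x. a * f x + c * h x) has_derivative
        (\<lambda>v. a * frechet_derivative f (at x) v + c * frechet_derivative h (at x) v)) (at x)"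
      if "x \<in> S" for x
      using Suc.prems that
      by (auto intro!: has_derivative_add has_derivative_mult_right simp: frechet_derivative_works)
  qed (use Suc in auto)
qed

text \<open>The Leibniz rule expresses the derivative of \<open>f h\<close> by products of \<open>f\<close> and \<open>h\<close> with
  derivatives of order one less; this is why \<open>times_differentiable_on_Suc_imp\<close> is required for the
  undifferentiated factors.\<close>

lemma times_differentiable_on_mult:
  fixes f h :: "'e::real_normed_vector \<Rightarrow> real"
  assumes "open S" "times_differentiable_on k S f" "times_differentiable_on k S h"
  shows "times_differentiable_on k S (\<lambda>x. f x * h x)"
  using assms(2,3)
proof (induction k arbitrary: f h)
  case 0
  then show ?case by (auto intro!: continuous_intros)
next
  case (Suc k)
  show ?case
  proof (rule times_differentiable_on_SucI[OF assms(1)])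
    show "((\<lambda>x. f x * h x) has_derivative
        (\<lambda>v. f x * frechet_derivative h (at x) v + frechet_derivative f (at x) v * h x)) (at x)"
      if "x \<in> S" for x
      using Suc.prems that
      by (intro has_derivative_mult) (auto simp flip: frechet_derivative_works)
    show "times_differentiable_on k S
        (\<lambda>x. f x * frechet_derivative h (at x) v + frechet_derivative f (at x) v * h x)" for v
    proof -
      note Suc.prems[THEN times_differentiable_on_Suc_imp]
      then have "times_differentiable_on k S (\<lambda>x. f x * frechet_derivative h (at x) v)"
        "times_differentiable_on k S (\<lambda>x. frechet_derivative f (at x) v * h x)"
        using Suc.prems by (auto intro!: Suc.IH)
      then show ?thesis
        using times_differentiable_on_lincomb[OF assms(1), where a = 1 and c = 1] by fastforce
    qed
  qed
qed

text \<open>The smooth functions form an algebra because differentiability on an open chart image is a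
  local property; injective charts that cover the space allow maps to be tested in coordinates.\<close>

definition open_charts :: "('a, 'e::real_normed_vector) atlas \<Rightarrow> bool" where
  "open_charts A \<longleftrightarrow> (\<forall>U \<phi>. (U, \<phi>) \<in> A \<longrightarrow> inj_on \<phi> U \<and> open (\<phi> ` U)) \<and>
     (\<forall>p. \<exists>U \<phi>. (U, \<phi>) \<in> A \<and> p \<in> U)"

lemma open_chartsD:
  assumes "open_charts A" "(U, \<phi>) \<in> A"
  shows "inj_on \<phi> U" "open (\<phi> ` U)"
  using assms by (simp_all add: open_charts_def)

lemma open_charts_cover:
  assumes "open_charts A"
  obtains U \<phi> where "(U, \<phi>) \<in> A" "p \<in> U"
  using assms unfolding open_charts_def by metis

lemma smooth_manifold_open_charts:
  assumes "smooth_manifold A"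
  shows "open_charts A"
  unfolding open_charts_def
proof (intro conjI allI impI)
  fix U \<phi> assume "(U, \<phi>) \<in> A"
  then have "open (\<phi> ` U) \<and> homeomorphism U (\<phi> ` U) \<phi> (inv_into U \<phi>)"
    using assms by (auto simp: smooth_manifold_def)
  then show "inj_on \<phi> U" "open (\<phi> ` U)"
    by (auto intro: inj_on_inverseI dest: homeomorphism_apply1)
next
  fix p
  have "p \<in> (\<Union>(U, \<phi>)\<in>A. U)"
    using assms by (simp add: smooth_manifold_def)
  then show "\<exists>U \<phi>. (U, \<phi>) \<in> A \<and> p \<in> U" by auto
qed

lemma open_charts_prod:
  fixes A :: "('a, 'e::real_normed_vector) atlas" and A' :: "('b, 'f::real_normed_vector) atlas"
  assumes A: "open_charts A" and A': "open_charts A'"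
  shows "open_charts (prod_atlas A A')"
  unfolding open_charts_def
proof (intro conjI allI impI)
  fix P \<kappa> assume "(P, \<kappa>) \<in> prod_atlas A A'"
  then obtain U \<phi> V \<psi> where P: "P = U \<times> V" "\<kappa> = map_prod \<phi> \<psi>"
    and charts: "(U, \<phi>) \<in> A" "(V, \<psi>) \<in> A'"
    by (auto simp: prod_atlas_def)
  note inv = open_chartsD[OF A charts(1)] open_chartsD[OF A' charts(2)]
  show "inj_on \<kappa> P"
    unfolding P by (rule map_prod_inj_on[OF inv(1,3)])
  show "open (\<kappa> ` P)"
    unfolding P map_prod_surj_on[OF refl refl] by (rule open_Times[OF inv(2,4)])
next
  fix r :: "'a \<times> 'b"
  obtain U \<phi> where U: "(U, \<phi>) \<in> A" "fst r \<in> U"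
    using open_charts_cover[OF A] .
  obtain V \<psi> where V: "(V, \<psi>) \<in> A'" "snd r \<in> V"
    using open_charts_cover[OF A'] .
  have "(U \<times> V, map_prod \<phi> \<psi>) \<in> prod_atlas A A' \<and> r \<in> U \<times> V"
    using U V by (auto simp: prod_atlas_def mem_Times_iff)
  then show "\<exists>P \<kappa>. (P, \<kappa>) \<in> prod_atlas A A' \<and> r \<in> P" by blast
qed

lemma smooth_functions_iff:
  "f \<in> smooth_functions A \<longleftrightarrow> (\<forall>U \<phi> k. (U, \<phi>) \<in> A \<longrightarrow>
     times_differentiable_on k (\<phi> ` U) (\<lambda>y. f (inv_into U \<phi> y)))"
  by (auto simp: smooth_functions_def smooth_on_def o_def)

lemma smooth_functions_const: "(\<lambda>_. c) \<in> smooth_functions A"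
  by (simp add: smooth_functions_iff times_differentiable_on_const)

lemma smooth_functions_lincomb:
  assumes "open_charts A" "f \<in> smooth_functions A" "h \<in> smooth_functions A"
  shows "(\<lambda>x. a * f x + c * h x) \<in> smooth_functions A"
  using assms(2,3) open_chartsD(2)[OF assms(1)]
  by (simp add: smooth_functions_iff times_differentiable_on_lincomb)

lemma smooth_functions_mult:
  assumes "open_charts A" "f \<in> smooth_functions A" "h \<in> smooth_functions A"
  shows "(\<lambda>x. f x * h x) \<in> smooth_functions A"
  using assms(2,3) open_chartsD(2)[OF assms(1)]
  by (simp add: smooth_functions_iff times_differentiable_on_mult)


section \<open>Smooth maps of a product\<close>

text \<open>Tangent vectors are derivations on globally defined smooth functions, so what matters about
  a map is that it pulls such functions back to smooth functions.\<close>

definition smooth_map ::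
    "('a, 'e::real_normed_vector) atlas \<Rightarrow> ('b, 'f::real_normed_vector) atlas \<Rightarrow> ('a \<Rightarrow> 'b) \<Rightarrow> bool"
  where "smooth_map A A' \<Phi> \<longleftrightarrow> (\<forall>f\<in>smooth_functions A'. f \<circ> \<Phi> \<in> smooth_functions A)"

text \<open>The projections of a product and the inclusions of its leaves are all affine in suitable
  charts, and for such maps \<open>times_differentiable_on_affine\<close> replaces the general chain rule.\<close>

lemma smooth_map_if_affine_in_charts:
  fixes A :: "('a, 'e::real_normed_vector) atlas" and A' :: "('b, 'f::real_normed_vector) atlas"
  assumes "open_charts A"
    and "\<And>U \<phi>. (U, \<phi>) \<in> A \<Longrightarrow> \<exists>V \<psi> L c. (V, \<psi>) \<in> A' \<and> inj_on \<psi> V \<and> bounded_linear L \<and>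
      (\<forall>x\<in>U. \<Phi> x \<in> V \<and> \<psi> (\<Phi> x) = L (\<phi> x) + c)"
  shows "smooth_map A A' \<Phi>"
  unfolding smooth_map_def
proof
  fix f assume f: "f \<in> smooth_functions A'"
  show "f \<circ> \<Phi> \<in> smooth_functions A"
    unfolding smooth_functions_iff
  proof (intro allI impI)
    fix U \<phi> k assume U: "(U, \<phi>) \<in> A"
    note inj = open_chartsD(1)[OF assms(1) U] and op = open_chartsD(2)[OF assms(1) U]
    obtain V \<psi> L c where V: "(V, \<psi>) \<in> A'" "inj_on \<psi> V" and L: "bounded_linear L"
      and aff: "\<And>x. x \<in> U \<Longrightarrow> \<Phi> x \<in> V \<and> \<psi> (\<Phi> x) = L (\<phi> x) + c"
      using assms(2)[OF U] by blast
    have "times_differentiable_on k (\<psi> ` V) (\<lambda>y. f (inv_into V \<psi> y))"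
      using f V by (simp add: smooth_functions_iff)
    moreover have "(\<lambda>y. L y + c) ` \<phi> ` U \<subseteq> \<psi> ` V"
    proof clarify
      fix x assume "x \<in> U"
      from aff[OF this] show "L (\<phi> x) + c \<in> \<psi> ` V"
        by (metis imageI)
    qed
    ultimately have *: "times_differentiable_on k (\<phi> ` U) (\<lambda>y. f (inv_into V \<psi> (L y + c)))"
      using op L by (intro times_differentiable_on_affine)
    show "times_differentiable_on k (\<phi> ` U) (\<lambda>y. (f \<circ> \<Phi>) (inv_into U \<phi> y))"
    proof (rule times_differentiable_on_cong[OF op _ *])
      fix y assume "y \<in> \<phi> ` U"
      then obtain x where "x \<in> U" "y = \<phi> x" by blast
      with aff[of x] inj V(2)
      show "f (inv_into V \<psi> (L y + c)) = (f \<circ> \<Phi>) (inv_into U \<phi> y)"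
        by (metis comp_apply inv_into_f_f)
    qed
  qed
qed

context
  fixes A :: "('a, 'e::real_normed_vector) atlas" and A' :: "('b, 'f::real_normed_vector) atlas"
  assumes A: "open_charts A" and A': "open_charts A'"
begin

lemma smooth_map_fst: "smooth_map (prod_atlas A A') A fst"
proof (rule smooth_map_if_affine_in_charts[OF open_charts_prod[OF A A']])
  fix P \<kappa> assume "(P, \<kappa>) \<in> prod_atlas A A'"
  then obtain U \<phi> V \<psi> where P: "P = U \<times> V" "\<kappa> = map_prod \<phi> \<psi>"
    and charts: "(U, \<phi>) \<in> A" "(V, \<psi>) \<in> A'"
    by (auto simp: prod_atlas_def)
  have "inj_on \<phi> U"
    by (rule open_chartsD(1)[OF A charts(1)])
  moreover have "\<forall>x\<in>P. fst x \<in> U \<and> \<phi> (fst x) = fst (\<kappa> x) + 0"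
    by (auto simp: P)
  ultimately show "\<exists>U \<phi> L c. (U, \<phi>) \<in> A \<and> inj_on \<phi> U \<and> bounded_linear L \<and>
      (\<forall>x\<in>P. fst x \<in> U \<and> \<phi> (fst x) = L (\<kappa> x) + c)"
    by (intro exI[of _ U] exI[of _ "\<phi>"] exI[of _ fst] exI[of _ 0] conjI charts bounded_linear_fst)
qed

lemma smooth_map_snd: "smooth_map (prod_atlas A A') A' snd"
proof (rule smooth_map_if_affine_in_charts[OF open_charts_prod[OF A A']])
  fix P \<kappa> assume "(P, \<kappa>) \<in> prod_atlas A A'"
  then obtain U \<phi> V \<psi> where P: "P = U \<times> V" "\<kappa> = map_prod \<phi> \<psi>"
    and charts: "(U, \<phi>) \<in> A" "(V, \<psi>) \<in> A'"
    by (auto simp: prod_atlas_def)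
  have "inj_on \<psi> V"
    by (rule open_chartsD(1)[OF A' charts(2)])
  moreover have "\<forall>x\<in>P. snd x \<in> V \<and> \<psi> (snd x) = snd (\<kappa> x) + 0"
    by (auto simp: P)
  ultimately show "\<exists>V \<psi> L c. (V, \<psi>) \<in> A' \<and> inj_on \<psi> V \<and> bounded_linear L \<and>
      (\<forall>x\<in>P. snd x \<in> V \<and> \<psi> (snd x) = L (\<kappa> x) + c)"
    by (intro exI[of _ V] exI[of _ "\<psi>"] exI[of _ snd] exI[of _ 0] conjI charts bounded_linear_snd)
qed

lemma smooth_map_base_leaf: "smooth_map A (prod_atlas A A') (\<lambda>x. (x, q))"
proof (rule smooth_map_if_affine_in_charts[OF A])
  fix U \<phi> assume U: "(U, \<phi>) \<in> A"
  obtain V \<psi> where V: "(V, \<psi>) \<in> A'" "q \<in> V"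
    using open_charts_cover[OF A'] .
  have P: "(U \<times> V, map_prod \<phi> \<psi>) \<in> prod_atlas A A'"
    using U V by (auto simp: prod_atlas_def)
  moreover have "inj_on (map_prod \<phi> \<psi>) (U \<times> V)"
    by (rule open_chartsD(1)[OF open_charts_prod[OF A A'] P])
  moreover have "bounded_linear (\<lambda>y::'e. (y, 0::'f))"
    by (intro bounded_linear_Pair bounded_linear_ident bounded_linear_zero)
  ultimately show "\<exists>V \<psi> L c. (V, \<psi>) \<in> prod_atlas A A' \<and> inj_on \<psi> V \<and> bounded_linear L \<and>
      (\<forall>x\<in>U. (x, q) \<in> V \<and> \<psi> (x, q) = L (\<phi> x) + c)"
    using V(2)
    by (intro exI[of _ "U \<times> V"] exI[of _ "map_prod \<phi> \<psi>"] exI[of _ "(\<lambda>y. (y, 0))"]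
        exI[of _ "(0, \<psi> q)"] conjI) simp_all
qed

lemma smooth_map_fibre_leaf: "smooth_map A' (prod_atlas A A') (\<lambda>y. (p, y))"
proof (rule smooth_map_if_affine_in_charts[OF A'])
  fix V \<psi> assume V: "(V, \<psi>) \<in> A'"
  obtain U \<phi> where U: "(U, \<phi>) \<in> A" "p \<in> U"
    using open_charts_cover[OF A] .
  have P: "(U \<times> V, map_prod \<phi> \<psi>) \<in> prod_atlas A A'"
    using U V by (auto simp: prod_atlas_def)
  moreover have "inj_on (map_prod \<phi> \<psi>) (U \<times> V)"
    by (rule open_chartsD(1)[OF open_charts_prod[OF A A'] P])
  moreover have "bounded_linear (\<lambda>y::'f. (0::'e, y))"
    by (intro bounded_linear_Pair bounded_linear_ident bounded_linear_zero)
  ultimately show "\<exists>U \<phi> L c. (U, \<phi>) \<in> prod_atlas A A' \<and> inj_on \<phi> U \<and> bounded_linear L \<and>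
      (\<forall>y\<in>V. (p, y) \<in> U \<and> \<phi> (p, y) = L (\<psi> y) + c)"
    using U(2)
    by (intro exI[of _ "U \<times> V"] exI[of _ "map_prod \<phi> \<psi>"] exI[of _ "(\<lambda>y. (0, y))"]
        exI[of _ "(\<phi> p, 0)"] conjI) simp_all
qed

end


section \<open>Derivations, related fields and brackets\<close>

lemma tangent_lincomb:
  assumes "v \<in> tangent_space A p" "f \<in> smooth_functions A" "h \<in> smooth_functions A"
  shows "v (\<lambda>x. a * f x + c * h x) = a * v f + c * v h"
  using assms by (simp add: tangent_space_def)

lemma tangent_mult:
  assumes "v \<in> tangent_space A p" "f \<in> smooth_functions A" "h \<in> smooth_functions A"
  shows "v (\<lambda>x. f x * h x) = v f * h p + f p * v h"
  using assms by (simp add: tangent_space_def)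

lemma tangent_not_smooth: "v \<in> tangent_space A p \<Longrightarrow> f \<notin> smooth_functions A \<Longrightarrow> v f = 0"
  by (simp add: tangent_space_def)

lemma tangent_const:
  assumes "v \<in> tangent_space A p"
  shows "v (\<lambda>_. c) = 0"
proof -
  \<comment> \<open>The Leibniz rule at \<open>1 = 1 \<cdot> 1\<close> gives \<open>v 1 = 2 v 1\<close>.\<close>
  have "v (\<lambda>_. 1) = 0"
    using tangent_mult[OF assms smooth_functions_const[of 1] smooth_functions_const[of 1]] by simp
  then show ?thesis
    using tangent_lincomb[OF assms smooth_functions_const[of 1] smooth_functions_const[of 1],
        of c 0] by simp
qed

lemma zero_tangent: "(\<lambda>_. 0) \<in> tangent_space A p"
  by (simp add: tangent_space_def)

lemma zero_vector_field: "(\<lambda>_ _. 0) \<in> vector_fields A"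
  by (simp add: vector_fields_def zero_tangent smooth_functions_const)

lemma vector_field_tangent: "X \<in> vector_fields A \<Longrightarrow> X p \<in> tangent_space A p"
  by (simp add: vector_fields_def)

lemma vector_field_smooth:
  "X \<in> vector_fields A \<Longrightarrow> f \<in> smooth_functions A \<Longrightarrow> (\<lambda>p. X p f) \<in> smooth_functions A"
  by (simp add: vector_fields_def)

lemma differential_tangent:
  assumes "open_charts A'" "smooth_map A A' \<Phi>" "v \<in> tangent_space A p"
  shows "differential A' \<Phi> v \<in> tangent_space A' (\<Phi> p)"
proof -
  have pull: "f \<circ> \<Phi> \<in> smooth_functions A" if "f \<in> smooth_functions A'" for f
    using assms(2) that by (simp add: smooth_map_def)
  show ?thesis
    using tangent_lincomb[OF assms(3) pull pull] tangent_mult[OF assms(3) pull pull]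
      smooth_functions_lincomb[OF assms(1)] smooth_functions_mult[OF assms(1)]
    by (simp add: tangent_space_def differential_def o_def)
qed

lemma differential_comp:
  assumes "smooth_map A' A'' \<Psi>"
  shows "differential A'' \<Psi> (differential A' \<Phi> v) = differential A'' (\<Psi> \<circ> \<Phi>) v"
  using assms by (auto simp: differential_def smooth_map_def fun_eq_iff o_assoc)

text \<open>That \<open>v\<close> is tangent matters here: \<open>differential\<close> truncates to \<open>0\<close> on non-smooth functions,
  which changes nothing only because \<open>v\<close> vanishes there.\<close>

lemma differential_ident:
  assumes "v \<in> tangent_space A p"
  shows "differential A (\<lambda>x. x) v = v"
  using tangent_not_smooth[OF assms] by (auto simp: differential_def o_def fun_eq_iff)

lemma differential_const:
  assumes "v \<in> tangent_space A p"
  shows "differential A' (\<lambda>_. c) v = (\<lambda>_. 0)"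
  using tangent_const[OF assms] by (auto simp: differential_def o_def fun_eq_iff)

text \<open>On a product \<open>f h\<close>, the composites \<open>X Y\<close> and \<open>Y X\<close> both miss the Leibniz rule by the
  symmetric term \<open>X(f) Y(h) + Y(f) X(h)\<close>, which the commutator cancels.\<close>

lemma lie_bracket_tangent:
  assumes A: "open_charts A" and X: "X \<in> vector_fields A" and Y: "Y \<in> vector_fields A"
  shows "lie_bracket X Y p \<in> tangent_space A p"
proof -
  have lin: "E p (\<lambda>q. G q (\<lambda>x. a * f x + c * h x))
      = a * E p (\<lambda>q. G q f) + c * E p (\<lambda>q. G q h)"
    if "E \<in> vector_fields A" "G \<in> vector_fields A"
      "f \<in> smooth_functions A" "h \<in> smooth_functions A" for E G f h a c
    using tangent_lincomb[OF vector_field_tangent[OF that(1)]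
        vector_field_smooth[OF that(2,3)] vector_field_smooth[OF that(2,4)]]
    by (simp add: tangent_lincomb[OF vector_field_tangent[OF that(2)] that(3,4)])
  have leib: "E p (\<lambda>q. G q (\<lambda>x. f x * h x))
      = E p (\<lambda>q. G q f) * h p + G p f * E p h + E p f * G p h + f p * E p (\<lambda>q. G q h)"
    if E: "E \<in> vector_fields A" and G: "G \<in> vector_fields A"
      and f: "f \<in> smooth_functions A" and h: "h \<in> smooth_functions A" for E G f h
  proof -
    note s = f h vector_field_smooth[OF G f] vector_field_smooth[OF G h]
    have "E p (\<lambda>q. G q (\<lambda>x. f x * h x)) = E p (\<lambda>q. G q f * h q + f q * G q h)"
      by (simp add: tangent_mult[OF vector_field_tangent[OF G] f h])
    also have "\<dots> = E p (\<lambda>q. G q f * h q) + E p (\<lambda>q. f q * G q h)"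
      using tangent_lincomb[OF vector_field_tangent[OF E], where a = 1 and c = 1] s
        smooth_functions_mult[OF A] by fastforce
    finally show ?thesis
      using s by (simp add: tangent_mult[OF vector_field_tangent[OF E]])
  qed
  have zero: "E p (\<lambda>q. G q f) = 0"
    if "E \<in> vector_fields A" "G \<in> vector_fields A" "f \<notin> smooth_functions A" for E G f
    using that
    by (simp add: tangent_not_smooth[OF vector_field_tangent]
        tangent_const[OF vector_field_tangent])
  show ?thesis
    by (simp add: tangent_space_def lie_bracket_def lin[OF X Y] lin[OF Y X] leib[OF X Y]
        leib[OF Y X] zero[OF X Y] zero[OF Y X] algebra_simps)
qed

lemma lie_bracket_zero:
  assumes "X \<in> vector_fields A"
  shows "lie_bracket X (\<lambda>_ _. 0) p = (\<lambda>_. 0)" "lie_bracket (\<lambda>_ _. 0) X p = (\<lambda>_. 0)"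
  using tangent_const[OF vector_field_tangent[OF assms]] by (auto simp: lie_bracket_def)

definition related :: "('b, 'f::real_normed_vector) atlas \<Rightarrow> ('a \<Rightarrow> 'b)
    \<Rightarrow> ('a \<Rightarrow> 'a tangent) \<Rightarrow> ('b \<Rightarrow> 'b tangent) \<Rightarrow> bool" where
  "related A' \<Phi> E X \<longleftrightarrow> (\<forall>r. differential A' \<Phi> (E r) = X (\<Phi> r))"

text \<open>In the form in which relatedness is used: \<open>E\<close> acts on pullbacks as \<open>X\<close> acts downstairs.\<close>

lemma related_apply:
  assumes "related A' \<Phi> E X" "f \<in> smooth_functions A'"
  shows "E r (\<lambda>s. f (\<Phi> s)) = X (\<Phi> r) f"
  using assms by (auto simp: related_def differential_def o_def dest!: spec[of _ r] fun_cong[of _ _ f])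

text \<open>Both second-order terms of \<open>[E, G](f \<circ> \<Phi>)\<close> are pullbacks, since \<open>G(f \<circ> \<Phi>) = Y(f) \<circ> \<Phi>\<close> and
  \<open>Y(f)\<close> is smooth again, so \<open>related_apply\<close> can be used a second time. On a non-smooth \<open>f\<close> both
  sides are zero by convention.\<close>

lemma lie_bracket_related:
  assumes X: "X \<in> vector_fields A'" and Y: "Y \<in> vector_fields A'"
    and E: "related A' \<Phi> E X" and G: "related A' \<Phi> G Y"
  shows "related A' \<Phi> (lie_bracket E G) (lie_bracket X Y)"
proof -
  have smooth: "E r (\<lambda>s. G s (\<lambda>t. f (\<Phi> t))) - G r (\<lambda>s. E s (\<lambda>t. f (\<Phi> t)))
      = lie_bracket X Y (\<Phi> r) f" if f: "f \<in> smooth_functions A'" for f r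
    using related_apply[OF E vector_field_smooth[OF Y f]]
      related_apply[OF G vector_field_smooth[OF X f]]
    by (simp add: lie_bracket_def related_apply[OF E f] related_apply[OF G f])
  have "lie_bracket X Y p f = 0" if "f \<notin> smooth_functions A'" for p f
    using that
    by (simp add: lie_bracket_def tangent_not_smooth[OF vector_field_tangent[OF X]]
        tangent_not_smooth[OF vector_field_tangent[OF Y]]
        tangent_const[OF vector_field_tangent[OF X]] tangent_const[OF vector_field_tangent[OF Y]])
  with smooth show ?thesis
    by (auto simp: related_def differential_def lie_bracket_def[of E G] o_def fun_eq_iff)
qed


section \<open>The Koszul form of a twisted product\<close>

lemma metric_zero:
  assumes "singular_semi_riemannian A g" "v \<in> tangent_space A p"
  shows "g p (\<lambda>_. 0) v = 0" "g p v (\<lambda>_. 0) = 0"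
proof -
  have lin: "g p (\<lambda>f. a * v f + c * v f) v = a * g p v v + c * g p v v" for a c
    using assms by (simp add: singular_semi_riemannian_def)
  from lin[of 0 0] show "g p (\<lambda>_. 0) v = 0" by simp
  moreover have "g p v (\<lambda>_. 0) = g p (\<lambda>_. 0) v"
    using assms zero_tangent[of A p] by (simp add: singular_semi_riemannian_def)
  ultimately show "g p v (\<lambda>_. 0) = 0" by simp
qed

text \<open>Since \<open>koszul\<close> is defined by the formula and is not tensorial term by term, two kinds of
  terms have to vanish: derivatives of the function zero, and metric terms in which the zero field
  meets the bracket of the other two. The latter needs that the bracket is tangent.\<close>

lemma koszul_zero:
  assumes g: "singular_semi_riemannian A g" and X: "X \<in> vector_fields A" and Y: "Y \<in> vector_fields A"
  shows "koszul g (\<lambda>_ _. 0) X Y p = 0" "koszul g X (\<lambda>_ _. 0) Y p = 0"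
    "koszul g X Y (\<lambda>_ _. 0) p = 0"
proof -
  have "open_charts A"
    using g by (simp add: singular_semi_riemannian_def smooth_manifold_open_charts)
  note t = vector_field_tangent[OF X] vector_field_tangent[OF Y] zero_tangent
    lie_bracket_tangent[OF this X Y] lie_bracket_tangent[OF this Y X]
  note s = t[THEN metric_zero(1)[OF g]] t[THEN metric_zero(2)[OF g]]
    lie_bracket_zero[OF X] lie_bracket_zero[OF Y] t(1,2)[THEN tangent_const]
  show "koszul g (\<lambda>_ _. 0) X Y p = 0" "koszul g X (\<lambda>_ _. 0) Y p = 0"
    "koszul g X Y (\<lambda>_ _. 0) p = 0"
    by (simp_all add: koszul_def s)
qed

context
  fixes AB :: "('b::{t2_space, second_countable_topology}, 'e::real_normed_vector) atlas"
    and AF :: "('f::{t2_space, second_countable_topology}, 'd::real_normed_vector) atlas"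
    and gB :: "'b \<Rightarrow> 'b tangent \<Rightarrow> 'b tangent \<Rightarrow> real"
    and gF :: "'f \<Rightarrow> 'f tangent \<Rightarrow> 'f tangent \<Rightarrow> real"
    and b :: "'b \<times> 'f \<Rightarrow> real"
  assumes B: "singular_semi_riemannian AB gB" and F: "singular_semi_riemannian AF gF"
    and b: "b \<in> smooth_functions (prod_atlas AB AF)"
begin

lemma open_charts_factors: "open_charts AB" "open_charts AF"
  using B F by (simp_all add: singular_semi_riemannian_def smooth_manifold_open_charts)

text \<open>Lifts from a factor are the case in which one of the two projections vanishes.\<close>

definition projects_to ::
    "('b \<times> 'f \<Rightarrow> ('b \<times> 'f) tangent) \<Rightarrow> ('b \<Rightarrow> 'b tangent) \<Rightarrow> ('f \<Rightarrow> 'f tangent) \<Rightarrow> bool" where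
  "projects_to E X U \<longleftrightarrow> (\<forall>r. E r \<in> tangent_space (prod_atlas AB AF) r) \<and>
     X \<in> vector_fields AB \<and> U \<in> vector_fields AF \<and> related AB fst E X \<and> related AF snd E U"

text \<open>The inclusion of a leaf followed by the projection to the factor that contains the leaf is
  the identity; followed by the other projection it is constant.\<close>

lemma lift_base_projects_to:
  assumes "X \<in> vector_fields AB"
  shows "projects_to (lift_base AB AF X) X (\<lambda>_ _. 0)"
proof -
  note o = open_charts_factors and t = vector_field_tangent[OF assms]
  show ?thesis
    using assms zero_vector_field t
      differential_tangent[OF open_charts_prod[OF o] smooth_map_base_leaf[OF o] t]
    by (auto simp: projects_to_def related_def lift_base_def o_def
        differential_comp[OF smooth_map_fst[OF o]] differential_comp[OF smooth_map_snd[OF o]]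
        differential_ident[OF t] differential_const[OF t])
qed

lemma lift_fibre_projects_to:
  assumes "V \<in> vector_fields AF"
  shows "projects_to (lift_fibre AB AF V) (\<lambda>_ _. 0) V"
proof -
  note o = open_charts_factors and t = vector_field_tangent[OF assms]
  show ?thesis
    using assms zero_vector_field t
      differential_tangent[OF open_charts_prod[OF o] smooth_map_fibre_leaf[OF o] t]
    by (auto simp: projects_to_def related_def lift_fibre_def o_def
        differential_comp[OF smooth_map_fst[OF o]] differential_comp[OF smooth_map_snd[OF o]]
        differential_ident[OF t] differential_const[OF t])
qed

lemma derivative_twisted_sum:
  assumes E: "projects_to E X U" and f: "f \<in> smooth_functions AB" and h: "h \<in> smooth_functions AF"
  shows "E r (\<lambda>s. f (fst s) + (b s)\<^sup>2 * h (snd s)) =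
    X (fst r) f + 2 * b r * E r b * h (snd r) + (b r)\<^sup>2 * U (snd r) h"
proof -
  note o = open_charts_factors
  note P = open_charts_prod[OF o]
  have t: "E r \<in> tangent_space (prod_atlas AB AF) r"
    using E unfolding projects_to_def by blast
  have f': "(\<lambda>s. f (fst s)) \<in> smooth_functions (prod_atlas AB AF)"
    using smooth_map_fst[OF o] f by (auto simp: smooth_map_def o_def)
  have h': "(\<lambda>s. h (snd s)) \<in> smooth_functions (prod_atlas AB AF)"
    using smooth_map_snd[OF o] h by (auto simp: smooth_map_def o_def)
  note bh = smooth_functions_mult[OF P b h'] smooth_functions_mult[OF P b
    smooth_functions_mult[OF P b h']]
  \<comment> \<open>The square is split as \<open>b (b h)\<close>: the product rule then applies twice, to smooth factors.\<close>
  have "E r (\<lambda>s. f (fst s) + b s * (b s * h (snd s)))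
      = E r (\<lambda>s. f (fst s)) + E r (\<lambda>s. b s * (b s * h (snd s)))"
    using tangent_lincomb[OF t f' bh(2), of 1 1] by simp
  also have "\<dots> = X (fst r) f + (E r b * (b r * h (snd r))
      + b r * (E r b * h (snd r) + b r * U (snd r) h))"
    using E related_apply[of AB fst E X f r] related_apply[of AF snd E U h r] f h
    by (simp add: tangent_mult[OF t b] bh h' projects_to_def)
  finally show ?thesis by (simp add: power2_eq_square algebra_simps)
qed

lemma twisted_metric_projects_to:
  assumes "related AB fst E X" "related AF snd E U" "related AB fst G Y" "related AF snd G V"
  shows "twisted_metric AB gB AF gF b r (E r) (G r) =
    gB (fst r) (X (fst r)) (Y (fst r)) + (b r)\<^sup>2 * gF (snd r) (U (snd r)) (V (snd r))"
  using assms unfolding twisted_metric_def related_def by metis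

text \<open>The derivative of \<open>b\<^sup>2\<close> along the field in each of the three slots contributes one extra term;
  the factor \<open>2\<close> cancels against the \<open>1/2\<close> in the Koszul formula.\<close>

lemma koszul_projects_to:
  assumes 1: "projects_to E1 X1 U1" and 2: "projects_to E2 X2 U2" and 3: "projects_to E3 X3 U3"
  shows "koszul (twisted_metric AB gB AF gF b) E1 E2 E3 (p, q) =
    koszul gB X1 X2 X3 p
    + b (p, q) * E1 (p, q) b * gF q (U2 q) (U3 q)
    + b (p, q) * E2 (p, q) b * gF q (U3 q) (U1 q)
    - b (p, q) * E3 (p, q) b * gF q (U1 q) (U2 q)
    + (b (p, q))\<^sup>2 * koszul gF U1 U2 U3 q"
proof -
  let ?g = "twisted_metric AB gB AF gF b"
  have deriv: "E r (\<lambda>s. ?g s (G s) (H s)) =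
      X (fst r) (\<lambda>x. gB x (Y x) (Z x))
      + 2 * b r * E r b * gF (snd r) (V (snd r)) (W (snd r))
      + (b r)\<^sup>2 * U (snd r) (\<lambda>y. gF y (V y) (W y))"
    if "projects_to E X U" "projects_to G Y V" "projects_to H Z W" for E G H X Y Z U V W r
  proof -
    have "(\<lambda>x. gB x (Y x) (Z x)) \<in> smooth_functions AB"
      "(\<lambda>y. gF y (V y) (W y)) \<in> smooth_functions AF"
      using that B F by (auto simp: singular_semi_riemannian_def projects_to_def)
    note sum = derivative_twisted_sum[OF that(1) this, of r]
    have "?g s (G s) (H s) = gB (fst s) (Y (fst s)) (Z (fst s))
        + (b s)\<^sup>2 * gF (snd s) (V (snd s)) (W (snd s))" for s
      using that(2,3) by (intro twisted_metric_projects_to) (simp_all add: projects_to_def)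
    then show ?thesis by (simp add: sum)
  qed
  have bracket: "?g r (E r) (lie_bracket G H r) =
      gB (fst r) (X (fst r)) (lie_bracket Y Z (fst r))
      + (b r)\<^sup>2 * gF (snd r) (U (snd r)) (lie_bracket V W (snd r))"
    if "projects_to E X U" "projects_to G Y V" "projects_to H Z W" for E G H X Y Z U V W r
    using that
    by (intro twisted_metric_projects_to lie_bracket_related) (simp_all add: projects_to_def)
  show ?thesis
    unfolding koszul_def deriv[OF 1 2 3] deriv[OF 2 3 1] deriv[OF 3 1 2]
      bracket[OF 1 2 3] bracket[OF 2 3 1] bracket[OF 3 1 2]
    by (simp add: algebra_simps add_divide_distrib diff_divide_distrib)
qed

end

theorem proposition5p3:
  fixes AB :: "('b::{t2_space, second_countable_topology}, 'e::real_normed_vector) atlas"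
    and AF :: "('f::{t2_space, second_countable_topology}, 'd::real_normed_vector) atlas"
    and gB :: "'b \<Rightarrow> 'b tangent \<Rightarrow> 'b tangent \<Rightarrow> real"
    and gF :: "'f \<Rightarrow> 'f tangent \<Rightarrow> 'f tangent \<Rightarrow> real"
    and b :: "'b \<times> 'f \<Rightarrow> real"
    and X Y Z :: "'b \<Rightarrow> 'b tangent"
    and U V W :: "'f \<Rightarrow> 'f tangent"
  assumes "singular_semi_riemannian AB gB"
    and "singular_semi_riemannian AF gF"
    and "b \<in> smooth_functions (prod_atlas AB AF)"
    and "X \<in> vector_fields AB" and "Y \<in> vector_fields AB" and "Z \<in> vector_fields AB"
    and "U \<in> vector_fields AF" and "V \<in> vector_fields AF" and "W \<in> vector_fields AF"
  shows
    "let K = koszul (twisted_metric AB gB AF gF b);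
         X' = lift_base AB AF X; Y' = lift_base AB AF Y; Z' = lift_base AB AF Z;
         U' = lift_fibre AB AF U; V' = lift_fibre AB AF V; W' = lift_fibre AB AF W
     in \<forall>p q.
       K X' Y' Z' (p, q) = koszul gB X Y Z p \<and>
       (K X' Y' W' (p, q) = 0 \<and> K X' W' Y' (p, q) = 0 \<and> K W' X' Y' (p, q) = 0) \<and>
       (K X' V' W' (p, q) = b (p, q) * X' (p, q) b * gF q (V q) (W q) \<and>
        K V' X' W' (p, q) = b (p, q) * X' (p, q) b * gF q (V q) (W q) \<and>
        - K V' W' X' (p, q) = b (p, q) * X' (p, q) b * gF q (V q) (W q)) \<and>
       K U' V' W' (p, q) =
         b (p, q) * U' (p, q) b * gF q (V q) (W q)
         + b (p, q) * V' (p, q) b * gF q (W q) (U q)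
         - b (p, q) * W' (p, q) b * gF q (U q) (V q)
         + (b (p, q))\<^sup>2 * koszul gF U V W q"
proof -
  note zero = metric_zero[OF assms(1)] metric_zero[OF assms(2)]
    koszul_zero[OF assms(1)] koszul_zero[OF assms(2)]
  note t = assms(4-9)[THEN vector_field_tangent]
  note base = assms(4-6)[THEN lift_base_projects_to[OF assms(1-3)]]
  note fibre = assms(7-9)[THEN lift_fibre_projects_to[OF assms(1-3)]]
  note K = koszul_projects_to[OF assms(1-3)]
  have sym: "gF q (W q) (V q) = gF q (V q) (W q)" for q
    using assms(2) t(5,6) by (simp add: singular_semi_riemannian_def)
  note vf = assms(4-9) zero_vector_field
  show ?thesis
    unfolding Let_def
    by (intro allI conjI)
      (simp_all add: K[OF base(1) base(2) base(3)] K[OF base(1) base(2) fibre(3)]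
        K[OF base(1) fibre(3) base(2)] K[OF fibre(3) base(1) base(2)]
        K[OF base(1) fibre(2) fibre(3)] K[OF fibre(2) base(1) fibre(3)]
        K[OF fibre(2) fibre(3) base(1)] K[OF fibre(1) fibre(2) fibre(3)]
        zero t zero_tangent vf sym)
qed

end
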